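(* Let $G$ be a simple mixed graph on $n$ vertices. Let $n^+$ and $n^-$ denote the number of positive and negative eigenvalues of $\mathcal{I}(G)$ (counted with multiplicity), respectively. Then the independence number $\alpha(G)$ satisfies $\alpha(G)\le\min\left\{\frac{2n-n^+}{2},\frac{2n-n^-}{2}\right\}$.
   Context: A mixed graph $G$ has a finite nonempty vertex set $V_G=\{v_1,\dots,v_n\}$, a finite set $E_G$ of (undirected) edges, each joining an unordered pair of vertices $\{u,v\}$ (a loop if $u=v$), and a finite set $\vec E_G$ of arcs, each going from $u$ to $v$ for an ordered pair $(u,v)$ of vertices (a directed loop if $u=v$); multiple edges, loops, arcs and directed loops are allowed. $G$ is simple if it has no loops, no directed loops, at most one edge joining any two vertices, and at most one arc from $u$ to $v$ for each ordered pair $(u,v)$ (an edge and arcs in both directions may coexist on the same pair of vertices). The integrated adjacency matrix $\mathcal{I}(G)$ is the real symmetric $2n\times 2n$ matrix $\begin{bmatrix}A&D\\ D^T&A\end{bmatrix}$, where $A_{ij}$ ($i\neq j$) is the number of edges joining $v_i$ and $v_j$, $A_{ii}$ is twice the number of loops at $v_i$, and $D_{ij}$ is the number of arcs from $v_i$ to $v_j$. Two vertices are adjacent if there is an edge joining them or an arc between them in at least one direction. An independent set is a set of vertices no two of which are adjacent; $\alpha(G)$ is the largest size of an independent set. *)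

theory Defs
  imports "Jordan_Normal_Form.Char_Poly"
begin

text \<open>
  Edges and arcs are named objects, so that parallel ones can be told apart. An edge \<open>e\<close> has
  the unordered pair \<open>ends G e = {u, v}\<close> of its end vertices, which is a singleton for a loop.
\<close>

record ('v, 'e, 'a) mixed_graph =
  verts :: "'v set"
  edges :: "'e set"
  arcs :: "'a set"
  ends :: "'e \<Rightarrow> 'v set"
  tail :: "'a \<Rightarrow> 'v"
  head :: "'a \<Rightarrow> 'v"

locale mixed_graph =
  fixes G :: "('v, 'e, 'a) mixed_graph"
  assumes finite_verts: "finite (verts G)"
    and verts_nonempty: "verts G \<noteq> {}"
    and finite_edges: "finite (edges G)"
    and finite_arcs: "finite (arcs G)"
    and ends_wf: "e \<in> edges G \<Longrightarrow> \<exists>u\<in>verts G. \<exists>v\<in>verts G. ends G e = {u, v}"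
    and tail_wf: "a \<in> arcs G \<Longrightarrow> tail G a \<in> verts G"
    and head_wf: "a \<in> arcs G \<Longrightarrow> head G a \<in> verts G"

definition edges_joining :: "('v, 'e, 'a) mixed_graph \<Rightarrow> 'v \<Rightarrow> 'v \<Rightarrow> 'e set" where
  "edges_joining G u v = {e \<in> edges G. ends G e = {u, v}}"

definition arcs_from_to :: "('v, 'e, 'a) mixed_graph \<Rightarrow> 'v \<Rightarrow> 'v \<Rightarrow> 'a set" where
  "arcs_from_to G u v = {a \<in> arcs G. tail G a = u \<and> head G a = v}"

locale simple_mixed_graph = mixed_graph +
  assumes no_loop: "u \<in> verts G \<Longrightarrow> edges_joining G u u = {}"
    and no_directed_loop: "u \<in> verts G \<Longrightarrow> arcs_from_to G u u = {}"
    and no_multi_edge: "u \<in> verts G \<Longrightarrow> v \<in> verts G \<Longrightarrow> card (edges_joining G u v) \<le> 1"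
    and no_multi_arc: "u \<in> verts G \<Longrightarrow> v \<in> verts G \<Longrightarrow> card (arcs_from_to G u v) \<le> 1"

text \<open>
  The matrices depend on an enumeration of the vertices, given as a list \<open>vs\<close>;
  \<open>vs ! i\<close> plays the role of $v_{i+1}$.
\<close>

definition edge_matrix :: "('v, 'e, 'a) mixed_graph \<Rightarrow> 'v list \<Rightarrow> real mat" where
  "edge_matrix G vs = mat (length vs) (length vs) (\<lambda>(i, j).
     if i = j then 2 * real (card (edges_joining G (vs ! i) (vs ! i)))
     else real (card (edges_joining G (vs ! i) (vs ! j))))"

definition arc_matrix :: "('v, 'e, 'a) mixed_graph \<Rightarrow> 'v list \<Rightarrow> real mat" where
  "arc_matrix G vs = mat (length vs) (length vs) (\<lambda>(i, j).
     real (card (arcs_from_to G (vs ! i) (vs ! j))))"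

definition integrated_adjacency_matrix :: "('v, 'e, 'a) mixed_graph \<Rightarrow> 'v list \<Rightarrow> real mat" where
  "integrated_adjacency_matrix G vs =
     four_block_mat (edge_matrix G vs) (arc_matrix G vs)
                    (transpose_mat (arc_matrix G vs)) (edge_matrix G vs)"

text \<open>
  Eigenvalues are counted with algebraic multiplicity; for the symmetric matrices considered
  here, this agrees with the geometric one and all complex eigenvalues are real.
\<close>

definition num_pos_eigenvalues :: "real mat \<Rightarrow> nat" where
  "num_pos_eigenvalues M = (\<Sum>x | eigenvalue M x \<and> x > 0. order x (char_poly M))"

definition num_neg_eigenvalues :: "real mat \<Rightarrow> nat" where
  "num_neg_eigenvalues M = (\<Sum>x | eigenvalue M x \<and> x < 0. order x (char_poly M))"

definition adjacent :: "('v, 'e, 'a) mixed_graph \<Rightarrow> 'v \<Rightarrow> 'v \<Rightarrow> bool" where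
  "adjacent G u v \<longleftrightarrow>
     edges_joining G u v \<noteq> {} \<or> arcs_from_to G u v \<noteq> {} \<or> arcs_from_to G v u \<noteq> {}"

definition independent_set :: "('v, 'e, 'a) mixed_graph \<Rightarrow> 'v set \<Rightarrow> bool" where
  "independent_set G S \<longleftrightarrow>
     S \<subseteq> verts G \<and> (\<forall>u\<in>S. \<forall>v\<in>S. u \<noteq> v \<longrightarrow> \<not> adjacent G u v)"

definition independence_number :: "('v, 'e, 'a) mixed_graph \<Rightarrow> nat" where
  "independence_number G = Max (card ` {S. independent_set G S})"

end

theory Submission
  imports Defs
begin

text \<open>
  The bound is an instance of inertia (Cvetkovic) bounds. If $S$ is independent, then in a simple
  graph the edge matrix and the arc matrix both vanish on $S \times S$, diagonal included. Hence the
  two copies of $S$ among the row indices of the integrated adjacency matrix carry a zero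
  principal submatrix of order $2|S|$. So the quadratic form of the matrix vanishes on a
  subspace of dimension $2|S|$ of $\mathbb{R}^{2n}$, and such a subspace leaves room for at most
  $2n - 2|S|$ positive eigenvalues, and likewise for at most $2n - 2|S|$ negative ones.

  The linear algebra behind the last step is \<open>inertia_bound\<close>: if the form of a real symmetric
  $m \times m$ matrix is nonpositive on a $k$-dimensional subspace, the matrix has at most $m - k$
  positive eigenvalues. It is proved by induction on $m$, removing one positive eigenvalue $l$ at
  a time rather than by diagonalising the matrix. A Householder reflection moves an eigenvector
  for $l$ to the first axis, so the matrix becomes block diagonal with blocks $l$ and $M'$, and
  its characteristic polynomial is $(x - l)$ times that of $M'$. Projecting the subspace away
  from the first axis loses no dimension, since the form is positive on that axis; and it keeps
  the form nonpositive, since only the nonnegative term $l y_0^2$ is dropped. When no positive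
  eigenvalue is left, the claim is only $k \le m$. Since each step splits a linear factor off the
  characteristic polynomial, the count is by algebraic multiplicity throughout. A factor
  $s = \pm 1$ in front of the form treats the two signs at once.
\<close>

section \<open>Reflections and injective matrices\<close>

lemma sum_row_indicator:
  fixes f :: "nat \<Rightarrow> real"
  assumes "i < n"
  shows "(\<Sum>k = 0..<n. (if i = k then 1 else 0) * f k) = f i"
    and "(\<Sum>k = 0..<n. (if k = i then 1 else 0) * f k) = f i"
  using assms by (simp_all add: if_distrib[of "\<lambda>a. a * _"] sum.delta sum.delta' cong: if_cong)

lemma scalar_prod_self_eq_0:
  fixes v :: "real vec"
  assumes "v \<in> carrier_vec n" "v \<bullet> v = 0"
  shows "v = 0\<^sub>v n"
proof -
  have "(\<Sum>i = 0..<n. v $ i * v $ i) = 0" using assms by (simp add: scalar_prod_def)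
  then have "\<forall>i\<in>{0..<n}. v $ i * v $ i = 0" by (subst (asm) sum_nonneg_eq_0_iff) auto
  then show ?thesis using assms by (intro eq_vecI) auto
qed

text \<open>
  With $r = |v|$ and $w = v - r e_0$, the reflection in the hyperplane orthogonal to $w$
  exchanges $v$ and $r e_0$. If $v = r e_0$ already, then $w = 0$, and division by zero turns
  the formula for $H$ into the identity matrix, which serves as well.
\<close>

lemma householder_reflection:
  fixes v :: "real vec"
  assumes v: "v \<in> carrier_vec (Suc m)" and v0: "v \<noteq> 0\<^sub>v (Suc m)"
  obtains H c where "H \<in> carrier_mat (Suc m) (Suc m)" "transpose_mat H = H"
    "H * H = 1\<^sub>m (Suc m)" "c \<noteq> 0" "H *\<^sub>v v = c \<cdot>\<^sub>v unit_vec (Suc m) 0"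
proof -
  let ?n = "Suc m"
  define r where "r = sqrt (v \<bullet> v)"
  have vv_ge: "v \<bullet> v \<ge> 0" by (auto simp: scalar_prod_def intro!: sum_nonneg)
  have vv: "v \<bullet> v \<noteq> 0" using scalar_prod_self_eq_0[OF v] v0 by auto
  have rr: "r * r = v \<bullet> v" and r0: "r \<noteq> 0" using vv_ge vv by (simp_all add: r_def)
  define w where "w i = v $ i - (if i = 0 then r else 0)" for i
  define d where "d = (\<Sum>i = 0..<?n. w i * w i)"
  define H where "H = mat ?n ?n (\<lambda>(i, j). (if i = j then 1 else 0) - 2 * w i * w j / d)"
  have H: "H \<in> carrier_mat ?n ?n" by (simp add: H_def)
  have sym: "transpose_mat H = H" by (rule eq_matI) (auto simp: H_def)
  have vv_sum: "(\<Sum>i = 0..<?n. v $ i * v $ i) = r * r" using v rr by (simp add: scalar_prod_def)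
  have wv: "(\<Sum>i = 0..<?n. w i * v $ i) = r * r - r * v $ 0"
    using vv_sum unfolding w_def sum.atLeast0_lessThan_Suc_shift
    by (simp add: algebra_simps)
  have d: "d = 2 * (r * r - r * v $ 0)"
    using vv_sum unfolding d_def w_def sum.atLeast0_lessThan_Suc_shift
    by (simp add: algebra_simps)
  have inv: "H * H = 1\<^sub>m ?n"
  proof (rule eq_matI)
    fix i j assume "i < dim_row (1\<^sub>m ?n :: real mat)" "j < dim_col (1\<^sub>m ?n :: real mat)"
    then have i: "i < ?n" and j: "j < ?n" by auto
    have "(H * H) $$ (i, j) = (\<Sum>k = 0..<?n.
        ((if i = k then 1 else 0) - 2 * w i * w k / d) * ((if k = j then 1 else 0) - 2 * w k * w j / d))"
      using i j by (simp add: H_def scalar_prod_def)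
    also have "\<dots> = (\<Sum>k = 0..<?n. (if i = k then 1 else 0) * ((if k = j then 1 else 0) - 2 * w k * w j / d)
        - (if k = j then 1 else 0) * (2 * w i * w k / d) + (4 * w i * w j / (d * d)) * (w k * w k))"
      by (intro sum.cong refl) (simp add: algebra_simps)
    also have "\<dots> = ((if i = j then 1 else 0) - 2 * w i * w j / d) - 2 * w i * w j / d
        + (4 * w i * w j / (d * d)) * d"
      unfolding sum.distrib sum_subtractf sum_row_indicator[OF i] sum_row_indicator[OF j]
      by (simp only: d_def sum_distrib_left)
    also have "\<dots> = (1\<^sub>m ?n :: real mat) $$ (i, j)" using i j by (cases "d = 0") auto
    finally show "(H * H) $$ (i, j) = (1\<^sub>m ?n :: real mat) $$ (i, j)" .
  qed (auto simp: H_def)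
  have "H *\<^sub>v v = r \<cdot>\<^sub>v unit_vec ?n 0"
  proof (rule eq_vecI)
    fix i assume "i < dim_vec (r \<cdot>\<^sub>v unit_vec ?n 0 :: real vec)"
    then have i: "i < ?n" by simp
    have "(H *\<^sub>v v) $ i = (\<Sum>k = 0..<?n. ((if i = k then 1 else 0) - 2 * w i * w k / d) * v $ k)"
      using i v by (simp add: H_def scalar_prod_def)
    also have "\<dots> = (\<Sum>k = 0..<?n. (if i = k then 1 else 0) * v $ k - 2 * w i / d * (w k * v $ k))"
      by (intro sum.cong refl) (simp add: algebra_simps)
    also have "\<dots> = v $ i - 2 * w i / d * (r * r - r * v $ 0)"
      unfolding sum_subtractf sum_row_indicator[OF i] by (simp only: sum_distrib_left[symmetric] wv)
    also have "\<dots> = v $ i - w i"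
    proof (cases "d = 0")
      case True
      then have "w i * w i = 0"
        using i unfolding d_def by (subst (asm) sum_nonneg_eq_0_iff) auto
      then show ?thesis by simp
    next
      case False
      have half: "r * r - r * v $ 0 = d / 2" using d by simp
      show ?thesis unfolding half using False by simp
    qed
    also have "\<dots> = (r \<cdot>\<^sub>v unit_vec ?n 0) $ i" using i by (simp add: w_def)
    finally show "(H *\<^sub>v v) $ i = (r \<cdot>\<^sub>v unit_vec ?n 0) $ i" .
  qed (simp add: H_def)
  with that H sym inv r0 show ?thesis by blast
qed

text \<open>
  If $k > m$, padding $N$ with zero rows to a square matrix gives determinant $0$, hence a
  nonzero kernel vector.
\<close>

lemma injective_mat_dim_le:
  fixes N :: "real mat"
  assumes N: "N \<in> carrier_mat m k"
    and inj: "\<And>x. x \<in> carrier_vec k \<Longrightarrow> N *\<^sub>v x = 0\<^sub>v m \<Longrightarrow> x = 0\<^sub>v k"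
  shows "k \<le> m"
proof (rule ccontr)
  assume "\<not> k \<le> m"
  then have mk: "m < k" by simp
  define A where "A = mat\<^sub>r k k (\<lambda>i. if i = m then 0\<^sub>v k else if i < m then row N i else 0\<^sub>v k)"
  have A: "A \<in> carrier_mat k k" by (simp add: A_def)
  have "det A = 0" unfolding A_def
    by (rule det_row_0[OF mk]) (use N in auto)
  with det_0_iff_vec_prod_zero_field[OF A] obtain x where
    x: "x \<in> carrier_vec k" "x \<noteq> 0\<^sub>v k" and Ax: "A *\<^sub>v x = 0\<^sub>v k" by auto
  have "N *\<^sub>v x = 0\<^sub>v m"
  proof (rule eq_vecI)
    fix i assume "i < dim_vec (0\<^sub>v m :: real vec)"
    then have i: "i < m" by simp
    have "(N *\<^sub>v x) $ i = (A *\<^sub>v x) $ i"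
      using i mk N by (simp add: A_def)
    then show "(N *\<^sub>v x) $ i = 0\<^sub>v m $ i" using Ax i mk by simp
  qed (use N in simp)
  with inj x show False by blast
qed

section \<open>The inertia bound\<close>

definition num_eigenvalues_of_sign :: "real \<Rightarrow> real mat \<Rightarrow> nat" where
  "num_eigenvalues_of_sign s M = (\<Sum>x | eigenvalue M x \<and> s * x > 0. order x (char_poly M))"

lemma char_poly_neq_0:
  fixes M :: "real mat"
  assumes "M \<in> carrier_mat m m"
  shows "char_poly M \<noteq> 0"
  using degree_monic_char_poly[OF assms] by auto

lemma num_eigenvalues_of_sign_deflate:
  fixes M M' :: "real mat"
  assumes M: "M \<in> carrier_mat m m" and M': "M' \<in> carrier_mat m' m'"
    and cp: "char_poly M = [:- l, 1:] * char_poly M'" and l: "s * l > 0"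
  shows "num_eigenvalues_of_sign s M = Suc (num_eigenvalues_of_sign s M')"
proof -
  note nz = char_poly_neq_0[OF M] char_poly_neq_0[OF M']
  let ?R = "{x. eigenvalue M x \<and> s * x > 0}" and ?R' = "{x. eigenvalue M' x \<and> s * x > 0}"
  have R: "?R = {x. poly (char_poly M) x = 0 \<and> s * x > 0}"
    and R': "?R' = {x. poly (char_poly M') x = 0 \<and> s * x > 0}"
    using eigenvalue_root_char_poly[OF M] eigenvalue_root_char_poly[OF M'] by auto
  have fin: "finite ?R" unfolding R by (rule finite_subset[OF _ poly_roots_finite[OF nz(1)]]) auto
  have lR: "l \<in> ?R" unfolding R using l cp by simp
  have sub: "?R' \<subseteq> ?R" unfolding R R' using cp by auto
  have ord: "order x (char_poly M) = (if x = l then 1 else 0) + order x (char_poly M')" for x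
  proof -
    have "order x [:- l, 1:] = (if x = l then 1 else 0)"
      using order_power_n_n[of l 1] by (auto simp: order_0I)
    then show ?thesis unfolding cp order_mult[OF nz(1)[unfolded cp]] by simp
  qed
  have "num_eigenvalues_of_sign s M = (\<Sum>x\<in>?R. (if x = l then 1 else 0) + order x (char_poly M'))"
    unfolding num_eigenvalues_of_sign_def ord ..
  also have "\<dots> = 1 + (\<Sum>x\<in>?R. order x (char_poly M'))"
    using fin lR by (simp add: sum.distrib sum.delta)
  also have "(\<Sum>x\<in>?R. order x (char_poly M')) = (\<Sum>x\<in>?R'. order x (char_poly M'))"
    by (rule sum.mono_neutral_right[OF fin sub]) (auto simp: R R' intro!: order_0I)
  finally show ?thesis by (simp add: num_eigenvalues_of_sign_def)
qed

lemma mult_mat_unit_vec_0: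
  assumes "A \<in> carrier_mat (Suc m) (Suc m)" "i < Suc m"
  shows "(A *\<^sub>v unit_vec (Suc m) 0) $ i = (A $$ (i, 0) :: real)"
  using assms by simp

text \<open>
  The matrix $N$ stands for the subspace that its columns span: having trivial kernel, it
  parametrises a subspace of dimension $k$.
\<close>

theorem inertia_bound:
  fixes M N :: "real mat"
  assumes "M \<in> carrier_mat m m" "transpose_mat M = M" "N \<in> carrier_mat m k"
    and "\<And>x. x \<in> carrier_vec k \<Longrightarrow> N *\<^sub>v x = 0\<^sub>v m \<Longrightarrow> x = 0\<^sub>v k"
    and "\<And>x. x \<in> carrier_vec k \<Longrightarrow> s * ((N *\<^sub>v x) \<bullet> (M *\<^sub>v (N *\<^sub>v x))) \<le> 0"
  shows "num_eigenvalues_of_sign s M + k \<le> m"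
  using assms
proof (induction m arbitrary: M N)
  case 0
  have "k = 0" using injective_mat_dim_le[OF "0.prems"(3,4)] by simp
  have "\<not> eigenvalue M x" for x
    using 0(1) by (auto simp: eigenvalue_def eigenvector_def)
  then have "num_eigenvalues_of_sign s M = 0" by (simp add: num_eigenvalues_of_sign_def)
  then show ?case using \<open>k = 0\<close> by simp
next
  case (Suc m)
  note M = Suc.prems(1) and symM = Suc.prems(2) and N = Suc.prems(3)
  note inj = Suc.prems(4) and form = Suc.prems(5)
  let ?n = "Suc m"
  show ?case
  proof (cases "\<exists>l. eigenvalue M l \<and> s * l > 0")
    case False
    then have "{x. eigenvalue M x \<and> s * x > 0} = {}" by blast
    then have "num_eigenvalues_of_sign s M = 0" unfolding num_eigenvalues_of_sign_def by (simp only: sum.empty)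
    then show ?thesis using injective_mat_dim_le[OF N inj] by simp
  next
    case True
    then obtain l v where l: "s * l > 0" and v: "v \<in> carrier_vec ?n" "v \<noteq> 0\<^sub>v ?n"
      and Mv: "M *\<^sub>v v = l \<cdot>\<^sub>v v"
      using M by (auto simp: eigenvalue_def eigenvector_def)
    obtain H c where H: "H \<in> carrier_mat ?n ?n" and symH: "transpose_mat H = H"
      and HH: "H * H = 1\<^sub>m ?n" and c: "c \<noteq> 0" and Hv: "H *\<^sub>v v = c \<cdot>\<^sub>v unit_vec ?n 0"
      by (rule householder_reflection[OF v])
    have HHx: "H *\<^sub>v (H *\<^sub>v x) = x" if "x \<in> carrier_vec ?n" for x
      using that H HH by (metis assoc_mult_mat_vec one_mult_mat_vec)
    \<comment> \<open>\<open>H\<close> is its own inverse and transpose, so \<open>B\<close> is both similar and congruent to \<open>M\<close>.\<close>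
    define B where "B = H * M * H"
    have B: "B \<in> carrier_mat ?n ?n" using H M by (simp add: B_def)
    have symB: "transpose_mat B = B"
      unfolding B_def using H M
      by (simp add: transpose_mult[of _ ?n ?n _ ?n] symH symM assoc_mult_mat[of _ ?n ?n _ ?n _ ?n])
    have Bx: "B *\<^sub>v x = H *\<^sub>v (M *\<^sub>v (H *\<^sub>v x))" if "x \<in> carrier_vec ?n" for x
      unfolding B_def using that H M by (simp add: assoc_mult_mat_vec[of _ ?n ?n _ ?n])
    have Be: "B *\<^sub>v unit_vec ?n 0 = l \<cdot>\<^sub>v unit_vec ?n 0"
    proof -
      have "c \<cdot>\<^sub>v (B *\<^sub>v unit_vec ?n 0) = B *\<^sub>v (H *\<^sub>v v)"
        unfolding Hv using B by (simp add: mult_mat_vec[of _ ?n ?n])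
      also have "\<dots> = H *\<^sub>v (l \<cdot>\<^sub>v v)" using Bx[of "H *\<^sub>v v"] HHx[OF v(1)] H v Mv by simp
      also have "\<dots> = l \<cdot>\<^sub>v (c \<cdot>\<^sub>v unit_vec ?n 0)" using H v Hv by (simp add: mult_mat_vec[of _ ?n ?n])
      finally have "(1 / c) \<cdot>\<^sub>v (c \<cdot>\<^sub>v (B *\<^sub>v unit_vec ?n 0)) = (1 / c) \<cdot>\<^sub>v (l \<cdot>\<^sub>v (c \<cdot>\<^sub>v unit_vec ?n 0))"
        by simp
      then show ?thesis using c by (simp add: smult_smult_assoc mult.commute)
    qed
    have col0: "B $$ (i, 0) = (if i = 0 then l else 0)" if "i < ?n" for i
      using mult_mat_unit_vec_0[OF B that] that unfolding Be by (cases "i = 0") simp_all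
    have row0: "B $$ (0, i) = (if i = 0 then l else 0)" if "i < ?n" for i
      using col0[OF that] symB that B by (metis carrier_matD index_transpose_mat(1) zero_less_Suc)
    define M' where "M' = mat m m (\<lambda>(i, j). B $$ (Suc i, Suc j))"
    have M': "M' \<in> carrier_mat m m" by (simp add: M'_def)
    have symM': "transpose_mat M' = M'"
    proof (rule eq_matI)
      fix i j assume "i < dim_row M'" "j < dim_col M'"
      then have ij: "i < m" "j < m" by (auto simp: M'_def)
      have "B $$ (Suc j, Suc i) = transpose_mat B $$ (Suc i, Suc j)" using ij B by simp
      then show "transpose_mat M' $$ (i, j) = M' $$ (i, j)" using ij symB by (simp add: M'_def)
    qed (auto simp: M'_def)
    have block: "B = four_block_mat (mat 1 1 (\<lambda>_. l)) (0\<^sub>m 1 m) (0\<^sub>m m 1) M'"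
      using B by (intro eq_matI) (auto simp: M'_def col0 row0)
    have "char_poly M = char_poly B"
    proof (rule char_poly_similar, rule similar_matI)
      show "{M, B, H, H} \<subseteq> carrier_mat ?n ?n" using M B H by auto
      have "H * (H * M * H) * H = (H * H) * M * (H * H)"
        using H M by (simp add: assoc_mult_mat[of _ ?n ?n _ ?n _ ?n])
      then show "M = H * B * H" using HH M unfolding B_def by simp
    qed (use HH in auto)
    also have "\<dots> = [:- l, 1:] * char_poly M'"
      unfolding block using M'
      by (subst char_poly_four_block_zeros_col) (auto simp: char_poly_defs det_single)
    finally have cp: "char_poly M = [:- l, 1:] * char_poly M'" .
    \<comment> \<open>\<open>K\<close> is the subspace in the new coordinates, \<open>N'\<close> its projection away from the first axis.\<close>
    define K where "K = H * N"
    have K: "K \<in> carrier_mat ?n k" using H N by (simp add: K_def)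
    define N' where "N' = mat m k (\<lambda>(i, j). K $$ (Suc i, j))"
    have N': "N' \<in> carrier_mat m k" by (simp add: N'_def)
    have Kx: "K *\<^sub>v x = H *\<^sub>v (N *\<^sub>v x)" if "x \<in> carrier_vec k" for x
      unfolding K_def by (rule assoc_mult_mat_vec[OF H N that])
    have N'x: "(N' *\<^sub>v x) $ i = (H *\<^sub>v (N *\<^sub>v x)) $ Suc i" if "x \<in> carrier_vec k" "i < m" for x i
      using that K unfolding Kx[OF that(1), symmetric] N'_def
      by (simp add: scalar_prod_def)
    have split_form: "(N *\<^sub>v x) \<bullet> (M *\<^sub>v (N *\<^sub>v x)) =
        l * ((H *\<^sub>v (N *\<^sub>v x)) $ 0)\<^sup>2 + (N' *\<^sub>v x) \<bullet> (M' *\<^sub>v (N' *\<^sub>v x))"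
      if x: "x \<in> carrier_vec k" for x
    proof -
      define y where "y = H *\<^sub>v (N *\<^sub>v x)"
      have Nx: "N *\<^sub>v x \<in> carrier_vec ?n" using N x by simp
      have y: "y \<in> carrier_vec ?n" unfolding y_def by (rule mult_mat_vec_carrier[OF H Nx])
      have yN': "N' *\<^sub>v x = vec m (\<lambda>i. y $ Suc i)"
        using N'x[OF x] N' by (intro eq_vecI) (auto simp: y_def)
      have Hy: "H *\<^sub>v y = N *\<^sub>v x" unfolding y_def using HHx[OF Nx] .
      have "(N *\<^sub>v x) \<bullet> (M *\<^sub>v (N *\<^sub>v x)) = (transpose_mat H *\<^sub>v y) \<bullet> (M *\<^sub>v (H *\<^sub>v y))"
        by (simp add: Hy symH)
      also have "\<dots> = y \<bullet> (B *\<^sub>v y)"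
        using transpose_vec_mult_scalar[OF H _ y, of "M *\<^sub>v (H *\<^sub>v y)"] Bx[OF y] M H y by simp
      also have "\<dots> = l * (y $ 0)\<^sup>2 + vec m (\<lambda>i. y $ Suc i) \<bullet> (M' *\<^sub>v vec m (\<lambda>i. y $ Suc i))"
        using y B by (simp add: scalar_prod_def sum.atLeast0_lessThan_Suc_shift col0 row0 M'_def
            power2_eq_square del: sum.op_ivl_Suc)
      finally show ?thesis unfolding yN' y_def .
    qed
    have "num_eigenvalues_of_sign s M' + k \<le> m"
    proof (rule Suc.IH[OF M' symM' N'])
      fix x assume x: "x \<in> carrier_vec k" and 0: "N' *\<^sub>v x = 0\<^sub>v m"
      let ?y = "H *\<^sub>v (N *\<^sub>v x)"
      \<comment> \<open>A vector projected to zero lies on the first axis, where the form is \<open>l\<close> times a square.\<close>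
      have "(N' *\<^sub>v x) \<bullet> (M' *\<^sub>v (N' *\<^sub>v x)) = 0" unfolding 0 using M' by simp
      then have "(s * l) * (?y $ 0)\<^sup>2 \<le> 0"
        using form[OF x] split_form[OF x] by (simp add: algebra_simps)
      then have y0: "?y $ 0 = 0" using mult_pos_pos[OF l, of "(?y $ 0)\<^sup>2"] by fastforce
      have "?y = 0\<^sub>v ?n"
      proof (rule eq_vecI)
        fix i assume "i < dim_vec (0\<^sub>v ?n :: real vec)"
        then show "?y $ i = 0\<^sub>v ?n $ i" using y0 N'x[OF x] 0 by (cases i) auto
      qed (use H in simp)
      moreover have "N *\<^sub>v x = H *\<^sub>v ?y" using HHx N x by simp
      moreover have "H *\<^sub>v 0\<^sub>v ?n = 0\<^sub>v ?n" using H by (intro eq_vecI) auto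
      ultimately have "N *\<^sub>v x = 0\<^sub>v ?n" by metis
      then show "x = 0\<^sub>v k" using inj x by blast
    next
      fix x :: "real vec" assume x: "x \<in> carrier_vec k"
      have "0 \<le> (s * l) * ((H *\<^sub>v (N *\<^sub>v x)) $ 0)\<^sup>2" using l by simp
      then show "s * ((N' *\<^sub>v x) \<bullet> (M' *\<^sub>v (N' *\<^sub>v x))) \<le> 0"
        using form[OF x] split_form[OF x] by (simp add: algebra_simps)
    qed
    then show ?thesis using num_eigenvalues_of_sign_deflate[OF M M' cp l] by simp
  qed
qed

corollary inertia_bound_zero_principal_submatrix:
  fixes M :: "real mat"
  assumes M: "M \<in> carrier_mat m m" and sym: "transpose_mat M = M"
    and T: "T \<subseteq> {0..<m}" and zero: "\<And>i j. i \<in> T \<Longrightarrow> j \<in> T \<Longrightarrow> M $$ (i, j) = 0"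
  shows "num_eigenvalues_of_sign s M + card T \<le> m"
proof -
  let ?k = "card T"
  have "finite T" using T finite_subset by blast
  then obtain f where f: "bij_betw f {0..<?k} T" using ex_bij_betw_nat_finite by blast
  \<comment> \<open>The columns of \<open>N\<close> are the unit vectors indexed by \<open>T\<close>.\<close>
  define N :: "real mat" where "N = mat m ?k (\<lambda>(i, j). if i = f j then 1 else 0)"
  have N: "N \<in> carrier_mat m ?k" by (simp add: N_def)
  have Nx: "(N *\<^sub>v x) $ i = (\<Sum>j = 0..<?k. (if i = f j then 1 else 0) * x $ j)"
    if "x \<in> carrier_vec ?k" "i < m" for x i
    using that by (simp add: N_def scalar_prod_def)
  have fT: "f j \<in> T" if "j < ?k" for j using f that by (auto simp: bij_betw_def)
  show ?thesis
  proof (rule inertia_bound[OF M sym N])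
    fix x :: "real vec" assume x: "x \<in> carrier_vec ?k" and 0: "N *\<^sub>v x = 0\<^sub>v m"
    show "x = 0\<^sub>v ?k"
    proof (rule eq_vecI)
      fix j assume "j < dim_vec (0\<^sub>v ?k :: real vec)"
      then have j: "j < ?k" by simp
      have fj: "f j < m" using fT[OF j] T by auto
      have "(\<Sum>i = 0..<?k. (if f j = f i then 1 else 0) * x $ i)
          = (\<Sum>i = 0..<?k. (if j = i then 1 else 0) * x $ i)"
        using f j by (intro sum.cong refl) (auto simp: bij_betw_def inj_on_def)
      then have "x $ j = (N *\<^sub>v x) $ f j"
        unfolding Nx[OF x fj] sum_row_indicator[OF j] by simp
      then show "x $ j = 0\<^sub>v ?k $ j" using 0 fj j by simp
    qed (use x in simp)
  next
    fix x :: "real vec" assume x: "x \<in> carrier_vec ?k"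
    define y where "y = N *\<^sub>v x"
    have y: "y \<in> carrier_vec m" unfolding y_def by (rule mult_mat_vec_carrier[OF N x])
    have supp: "y $ i = 0" if "i < m" "i \<notin> T" for i
      unfolding y_def Nx[OF x that(1)] using fT that(2) by (intro sum.neutral) auto
    have "y \<bullet> (M *\<^sub>v y) = (\<Sum>i = 0..<m. y $ i * (\<Sum>j = 0..<m. M $$ (i, j) * y $ j))"
      using y M by (simp add: scalar_prod_def)
    also have "\<dots> = (\<Sum>i = 0..<m. \<Sum>j = 0..<m. y $ i * M $$ (i, j) * y $ j)"
      by (simp add: sum_distrib_left mult.assoc)
    also have "\<dots> = 0" using supp zero by (intro sum.neutral ballI) fastforce
    finally show "s * ((N *\<^sub>v x) \<bullet> (M *\<^sub>v (N *\<^sub>v x))) \<le> 0" unfolding y_def by simp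
  qed
qed

section \<open>Independent sets and the integrated adjacency matrix\<close>

context mixed_graph
begin

lemma finite_independent_sets: "finite {S. independent_set G S}"
  by (rule finite_subset[of _ "Pow (verts G)"]) (auto simp: independent_set_def finite_verts)

lemma independence_number_attained:
  obtains S where "independent_set G S" "card S = independence_number G"
proof -
  have "{} \<in> {S. independent_set G S}" by (simp add: independent_set_def)
  then have "independence_number G \<in> card ` {S. independent_set G S}"
    unfolding independence_number_def using finite_independent_sets by (intro Max_in) auto
  then show ?thesis using that by auto
qed

end

lemma integrated_adjacency_matrix_carrier:
  "integrated_adjacency_matrix G vs \<in> carrier_mat (2 * length vs) (2 * length vs)"
  by (rule carrier_matI)
    (simp_all add: integrated_adjacency_matrix_def edge_matrix_def arc_matrix_def)

lemma edges_joining_commute: "edges_joining G u v = edges_joining G v u"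
  by (simp add: edges_joining_def insert_commute)

lemma integrated_adjacency_matrix_index:
  assumes "i < length vs" "j < length vs"
  shows "integrated_adjacency_matrix G vs $$ (i, j) = edge_matrix G vs $$ (i, j)"
    and "integrated_adjacency_matrix G vs $$ (i, j + length vs) = arc_matrix G vs $$ (i, j)"
    and "integrated_adjacency_matrix G vs $$ (i + length vs, j) = arc_matrix G vs $$ (j, i)"
    and "integrated_adjacency_matrix G vs $$ (i + length vs, j + length vs) = edge_matrix G vs $$ (i, j)"
  using assms by (simp_all add: integrated_adjacency_matrix_def edge_matrix_def arc_matrix_def)

lemma integrated_adjacency_matrix_symmetric:
  "transpose_mat (integrated_adjacency_matrix G vs) = integrated_adjacency_matrix G vs"
  by (rule eq_matI)
    (auto simp: integrated_adjacency_matrix_def edge_matrix_def arc_matrix_def edges_joining_commute)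

text \<open>
  Simplicity enters through the diagonal: an independent vertex could still carry a loop or a
  directed loop, which would make a diagonal entry of the edge or of the arc matrix nonzero.
\<close>

lemma (in simple_mixed_graph) independent_set_inertia_bound:
  assumes vs: "distinct vs" "set vs = verts G" and S: "independent_set G S"
  shows "num_eigenvalues_of_sign s (integrated_adjacency_matrix G vs) + 2 * card S \<le> 2 * length vs"
proof -
  let ?n = "length vs"
  define I where "I = {i. i < ?n \<and> vs ! i \<in> S}"
  define T where "T = I \<union> (\<lambda>i. i + ?n) ` I"
  have finI: "finite I" by (simp add: I_def)
  have SV: "S \<subseteq> verts G" using S by (simp add: independent_set_def)
  have "bij_betw (\<lambda>i. vs ! i) I S"
    unfolding bij_betw_def inj_on_def I_def using vs SV
    by (auto simp: nth_eq_iff_index_eq in_set_conv_nth image_iff) (metis in_set_conv_nth subsetD)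
  then have cI: "card I = card S" by (rule bij_betw_same_card)
  have "card T = card I + card ((\<lambda>i. i + ?n) ` I)"
    unfolding T_def by (rule card_Un_disjoint) (auto simp: finI I_def)
  then have cT: "card T = 2 * card S" using cI by (simp add: card_image inj_on_def)
  have no_edge: "edges_joining G (vs ! i) (vs ! j) = {}" if "i \<in> I" "j \<in> I" for i j
    using that S SV no_loop[of "vs ! i"]
    by (cases "vs ! i = vs ! j") (auto simp: I_def independent_set_def adjacent_def)
  have no_arc: "arcs_from_to G (vs ! i) (vs ! j) = {}" if "i \<in> I" "j \<in> I" for i j
    using that S SV no_directed_loop[of "vs ! i"]
    by (cases "vs ! i = vs ! j") (auto simp: I_def independent_set_def adjacent_def)
  have I_less: "i < ?n" if "i \<in> I" for i using that by (simp add: I_def)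
  have "num_eigenvalues_of_sign s (integrated_adjacency_matrix G vs) + card T \<le> 2 * ?n"
  proof (rule inertia_bound_zero_principal_submatrix)
    show "T \<subseteq> {0..<2 * ?n}" by (auto simp: T_def I_def)
    show "integrated_adjacency_matrix G vs $$ (i, j) = 0" if "i \<in> T" "j \<in> T" for i j
      using that I_less no_edge no_arc unfolding T_def
      by (auto simp: integrated_adjacency_matrix_index edge_matrix_def arc_matrix_def)
  qed (rule integrated_adjacency_matrix_carrier integrated_adjacency_matrix_symmetric)+
  then show ?thesis using cT by simp
qed

theorem theorem8p9:
  fixes G :: "('v, 'e, 'a) mixed_graph"
    and vs :: "'v list"
    and n n_pos n_neg :: nat
  assumes "simple_mixed_graph G"
    and "distinct vs" and "set vs = verts G"
    and "n = card (verts G)"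
    and "n_pos = num_pos_eigenvalues (integrated_adjacency_matrix G vs)"
    and "n_neg = num_neg_eigenvalues (integrated_adjacency_matrix G vs)"
  shows "real (independence_number G)
           \<le> min ((2 * real n - real n_pos) / 2) ((2 * real n - real n_neg) / 2)"
proof -
  interpret simple_mixed_graph G by (rule assms(1))
  let ?M = "integrated_adjacency_matrix G vs"
  obtain S where S: "independent_set G S" and card_S: "card S = independence_number G"
    by (rule independence_number_attained)
  have n: "n = length vs" using assms(2-4) distinct_card by metis
  have bound: "num_eigenvalues_of_sign s ?M + 2 * independence_number G \<le> 2 * n" for s
    using independent_set_inertia_bound[OF assms(2,3) S] card_S n by simp
  have "n_pos = num_eigenvalues_of_sign 1 ?M" "n_neg = num_eigenvalues_of_sign (- 1) ?M"
    using assms(5,6) unfolding num_pos_eigenvalues_def num_neg_eigenvalues_def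
      num_eigenvalues_of_sign_def by simp_all
  with bound[of 1] bound[of "- 1"] show ?thesis by simp
qed

end
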